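(* Let $\mathbb{V}$ be a real Hilbert space with norm $\|\cdot\|$ and let $\mathbb{J}$ be a finite nonempty set. Let $\{\mathbb{V}_j\}_{j\in\mathbb{J}}$ be a family of closed subspaces of $\mathbb{V}$ such that $\sum_{j\in\mathbb{J}}\mathbb{V}_j=\mathbb{V}$. Let $\{|||\cdot|||_j\}_{j\in\mathbb{J}}$ be a family of (local) norms such that, for every $j\in\mathbb{J}$, $|||\cdot|||_j$ is a norm on $\mathbb{V}_j$ which is equivalent to the restriction to $\mathbb{V}_j$ of the Hilbertian norm $\|\cdot\|$. For every $j\in\mathbb{J}$ define the local unit ball $B_j=\{v\in\mathbb{V}_j:|||v|||_j\le1\}$. Then there is a (unique) norm $|||\cdot|||$ on $\mathbb{V}$ with unit ball $\overline{\mathrm{co}}\big(\bigcup_{j\in\mathbb{J}}B_j\big)$, and it admits a dual norm $|||\cdot|||_\star$ with unit ball $\big(\bigcup_{j\in\mathbb{J}}B_j\big)^{\odot}$. Moreover, the norm $|||\cdot|||$ and the dual norm $|||\cdot|||_\star$ are equivalent to the Hilbertian norm $\|\cdot\|$, and have the following expressions. 1. The norm $|||\cdot|||$ is the infimal convolution of the functions $|||\cdot|||_j+\delta_{\mathbb{V}_j}$, $j\in\mathbb{J}$, that is, $$|||v|||=\inf\Big\{\sum_{j\in\mathbb{J}}|||v^{j}|||_j\;:\;v^{j}\in\mathbb{V}_j\ (j\in\mathbb{J}),\ \sum_{j\in\mathbb{J}}v^{j}=v\Big\},\qquad\forall v\in\mathbb{V}.$$ 2. For each $j\in\mathbb{J}$,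 the local norm $|||\cdot|||_j$ on $\mathbb{V}_j$ admits a local dual norm $|||\cdot|||_{j,\star}$ on $\mathbb{V}_j$, and $$|||v'|||_\star=\sup_{j\in\mathbb{J}}|||\pi_j(v')|||_{j,\star},\qquad\forall v'\in\mathbb{V},$$ where $\pi_j:\mathbb{V}\to\mathbb{V}_j$ is the orthogonal projection onto the closed subspace $\mathbb{V}_j$.
   Context: For $V\subset\mathbb{V}$: support function $\sigma_V(v')=\sup_{v\in V}\langle v,v'\rangle$; polar set $V^{\odot}=\{v'\in\mathbb{V}:\langle v,v'\rangle\le1\ \forall v\in V\}$; $\overline{\mathrm{co}}(V)$ is the closed convex hull. $\delta_{\mathbb{V}_j}$ is $0$ on $\mathbb{V}_j$ and $+\infty$ elsewhere, and $|||\cdot|||_j+\delta_{\mathbb{V}_j}$ is understood as $+\infty$ outside $\mathbb{V}_j$. The unit ball of a norm is the closed one. A norm on a Hilbert space (here $\mathbb{V}$, or $\mathbb{V}_j$ with the induced scalar product) admits a dual norm if the support function of its unit ball is a norm on that space; this support function is then the dual norm. Thus $|||v'|||_{j,\star}=\sup_{v\in B_j}\langle v,v'\rangle$ for $v'\in\mathbb{V}_j$. Two norms are equivalent if each is bounded by a positive constant times the other. *)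

theory Defs
  imports "HOL-Analysis.Analysis"
begin

(* A norm on a linear subspace W is represented by a total function whose values
   outside W are irrelevant. *)
definition norm_on :: "'a::real_vector set \<Rightarrow> ('a \<Rightarrow> real) \<Rightarrow> bool" where
  "norm_on W N \<longleftrightarrow>
     (\<forall>x\<in>W. 0 \<le> N x) \<and>
     (\<forall>x\<in>W. N x = 0 \<longleftrightarrow> x = 0) \<and>
     (\<forall>x\<in>W. \<forall>c. N (c *\<^sub>R x) = \<bar>c\<bar> * N x) \<and>
     (\<forall>x\<in>W. \<forall>y\<in>W. N (x + y) \<le> N x + N y)"

definition unit_ball_on :: "'a set \<Rightarrow> ('a \<Rightarrow> real) \<Rightarrow> 'a set" where
  "unit_ball_on W N = {x \<in> W. N x \<le> 1}"

definition equivalent_norms_on :: "'a set \<Rightarrow> ('a \<Rightarrow> real) \<Rightarrow> ('a \<Rightarrow> real) \<Rightarrow> bool" where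
  "equivalent_norms_on W N M \<longleftrightarrow>
     (\<exists>c>0. \<forall>x\<in>W. N x \<le> c * M x) \<and> (\<exists>c>0. \<forall>x\<in>W. M x \<le> c * N x)"

definition support_function :: "'a::real_inner set \<Rightarrow> 'a \<Rightarrow> ereal" where
  "support_function S y = (SUP x\<in>S. ereal (x \<bullet> y))"

definition polar_set :: "'a::real_inner set \<Rightarrow> 'a set" where
  "polar_set S = {y. \<forall>x\<in>S. x \<bullet> y \<le> 1}"

definition admits_dual_norm :: "'a::real_inner set \<Rightarrow> ('a \<Rightarrow> real) \<Rightarrow> bool" where
  "admits_dual_norm W N \<longleftrightarrow>
     (\<exists>D. norm_on W D \<and> (\<forall>y\<in>W. support_function (unit_ball_on W N) y = ereal (D y)))"

(* Only meaningful on W, and when admits_dual_norm W N holds: otherwise real_of_ereal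
   may send an infinite support function value to 0. *)
definition dual_norm :: "'a::real_inner set \<Rightarrow> ('a \<Rightarrow> real) \<Rightarrow> 'a \<Rightarrow> real" where
  "dual_norm W N y = real_of_ereal (support_function (unit_ball_on W N) y)"

(* The function delta_W of convex analysis, not the 0/1-valued indicator. *)
definition convex_indicator :: "'a set \<Rightarrow> 'a \<Rightarrow> ereal" where
  "convex_indicator W x = (if x \<in> W then 0 else \<infinity>)"

(* Intended for functions that do not take the value -\<infinity>. *)
definition infimal_convolution ::
    "'j set \<Rightarrow> ('j \<Rightarrow> 'a::real_vector \<Rightarrow> ereal) \<Rightarrow> 'a \<Rightarrow> ereal" where
  "infimal_convolution J f x = (INF w\<in>{w. (\<Sum>j\<in>J. w j) = x}. \<Sum>j\<in>J. f j (w j))"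

(* The library's closest_point requires the class heine_borel, which excludes
   infinite-dimensional Hilbert spaces. *)
definition orthogonal_projection :: "'a::real_inner set \<Rightarrow> 'a \<Rightarrow> 'a" where
  "orthogonal_projection W x = (THE y. y \<in> W \<and> x - y \<in> orthogonal_comp W)"

end

theory Submission
  imports Defs
begin

text \<open>
  The infimal convolution \<open>Ninf\<close> of the local norms dominates a multiple of the Hilbert norm. It is
  countably subadditive because the subspaces are complete, so Baire's theorem (in the form of
  Zabreiko's lemma) bounds it by a multiple of the Hilbert norm. A vector with \<open>Ninf v < 1\<close> is a
  subconvex combination of points of the local unit balls, and \<open>Ninf\<close> is continuous; hence its
  unit ball is the closed convex hull. A half-space bounds this hull iff it bounds every local
  ball, where \<open>v'\<close> may be replaced by its orthogonal projection; this computes the dual norm.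
\<close>

section \<open>Consequences of completeness: Baire category, absolute convergence, Zabreiko's
  lemma\<close>

lemma Baire_cover_nonempty_interior:
  fixes A :: "nat \<Rightarrow> 'a::complete_space set"
  assumes "\<And>n. closed (A n)" and "(\<Union>n. A n) = UNIV"
  obtains n where "interior (A n) \<noteq> {}"
proof (rule ccontr)
  assume "\<not> thesis"
  then have "\<And>n. interior (A n) = {}" using that by blast
  then have "euclidean interior_of (\<Union>(range A)) = {}"
    using assms(1) by (intro Baire_category_alt) (auto simp: completely_metrizable_space_euclidean)
  then show False using assms(2) by simp
qed

text \<open>
  The sort \<open>{real_inner, complete_space}\<close> does not entail the class \<open>banach\<close>, so library results
  about \<open>banach\<close> do not apply here.
\<close>

lemma summable_if_summable_norm:
  fixes f :: "nat \<Rightarrow> 'a::{real_normed_vector, complete_space}"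
  assumes "summable (\<lambda>k. norm (f k))"
  shows "summable f"
proof -
  have cauchy: "Cauchy (\<lambda>n. \<Sum>k<n. norm (f k))"
    using assms by (simp add: summable_iff_convergent convergent_Cauchy)
  have "Cauchy (\<lambda>n. \<Sum>k<n. f k)"
  proof (rule CauchyI')
    fix e :: real assume "e > 0"
    then obtain M where M: "\<forall>m\<ge>M. \<forall>n\<ge>M. norm ((\<Sum>k<m. norm (f k)) - (\<Sum>k<n. norm (f k))) < e"
      using CauchyD[OF cauchy] by blast
    have "norm ((\<Sum>k<m. f k) - (\<Sum>k<n. f k)) < e" if "m \<ge> M" "n > m" for m n
    proof -
      have sub: "{..<n} - {..<m} = {m..<n}" "{..<m} \<subseteq> {..<n}" using that by auto
      have "norm ((\<Sum>k<m. f k) - (\<Sum>k<n. f k)) = norm (\<Sum>k\<in>{m..<n}. f k)"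
        using sum_diff[of "{..<n}" "{..<m}" f] sub by (simp add: norm_minus_commute)
      also have "\<dots> \<le> (\<Sum>k\<in>{m..<n}. norm (f k))" by (rule norm_sum)
      also have "\<dots> = (\<Sum>k<n. norm (f k)) - (\<Sum>k<m. norm (f k))"
        using sum_diff[of "{..<n}" "{..<m}" "\<lambda>k. norm (f k)"] sub by simp
      also have "\<dots> < e" using M[rule_format, of n m] that by simp
      finally show ?thesis .
    qed
    then show "\<exists>M. \<forall>m\<ge>M. \<forall>n>m. dist (\<Sum>k<m. f k) (\<Sum>k<n. f k) < e"
      unfolding dist_norm by blast
  qed
  then show ?thesis by (simp add: summable_iff_convergent Cauchy_convergent)
qed

text \<open>
  The next three lemmas prove Zabreiko's lemma, which takes the place of the open mapping theorem for
  the sum map on the product of the subspaces.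
\<close>

lemma seminorm_sublevel_dense:
  fixes p :: "'a::{real_normed_vector, complete_space} \<Rightarrow> real"
  assumes scale: "\<And>c x. p (c *\<^sub>R x) = \<bar>c\<bar> * p x"
    and triangle: "\<And>x y. p (x + y) \<le> p x + p y"
  obtains C where "C > 0" "\<And>x e. e > 0 \<Longrightarrow> \<exists>u. p u \<le> C * norm x \<and> norm (x - u) < e"
proof -
  \<comment> \<open>No continuity of \<open>p\<close> is available at this point, so its sublevel
    sets need not be closed; their closures are, and they cover the space.\<close>
  define A where "A n = closure {x. p x \<le> real n}" for n
  have "(\<Union>n. A n) = UNIV"
  proof -
    have "x \<in> A (nat \<lceil>p x\<rceil>)" for x
      unfolding A_def using closure_subset real_nat_ceiling_ge by fastforce
    then show ?thesis by blast
  qed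
  then obtain n where "interior (A n) \<noteq> {}"
    using Baire_cover_nonempty_interior[of A] unfolding A_def by (metis closed_closure)
  then obtain x0 r where r: "r > 0" "ball x0 r \<subseteq> A n"
    by (meson all_not_in_conv mem_interior)
  \<comment> \<open>The ball around \<open>x0\<close> is moved to the origin: \<open>x0 + y\<close>
    and \<open>x0 - y\<close> both lie in \<open>A n\<close>, and half the difference of their
    approximants approximates \<open>y\<close>. Symmetry and the triangle inequality keep
    \<open>p\<close> at most \<open>n\<close> there.\<close>
  have approx: "\<exists>u. p u \<le> n \<and> norm (y - u) < e" if "norm y < r" "e > 0" for y e
  proof -
    have "x0 + y \<in> A n" "x0 - y \<in> A n"
      using r that by (auto simp: dist_norm subset_iff)
    then obtain a b where a: "p a \<le> n" "dist a (x0 + y) < e" and b: "p b \<le> n" "dist b (x0 - y) < e"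
      unfolding A_def closure_approachable using \<open>e > 0\<close> by blast
    define u where "u = (1/2) *\<^sub>R (a + (-1) *\<^sub>R b)"
    have "p u \<le> (p a + p b) / 2"
      unfolding u_def using triangle[of a "(-1) *\<^sub>R b"] scale[of "-1" b] scale[of "1/2"] by simp
    also have "\<dots> \<le> n" using a b by simp
    finally have "p u \<le> n" .
    have "y - u = (1/2) *\<^sub>R ((x0 + y - a) - (x0 - y - b))"
      unfolding u_def by (simp add: algebra_simps flip: scaleR_add_left)
    then have "norm (y - u) \<le> (norm (x0 + y - a) + norm (x0 - y - b)) / 2"
      using norm_triangle_ineq4[of "x0 + y - a" "x0 - y - b"] by simp
    also have "\<dots> < e" using a b by (simp add: dist_norm norm_minus_commute)
    finally show ?thesis using \<open>p u \<le> n\<close> by blast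
  qed
  \<comment> \<open>Undoing the scaling by \<open>s\<close> below multiplies the bound
    \<open>n\<close> by \<open>2 * norm x / r\<close>. Using \<open>n + 1\<close> keeps
    \<open>C\<close> positive when \<open>n = 0\<close>.\<close>
  define C where "C = 2 * (real n + 1) / r"
  show thesis
  proof
    show "C > 0" unfolding C_def using r by simp
    fix x :: 'a and e :: real assume "e > 0"
    show "\<exists>u. p u \<le> C * norm x \<and> norm (x - u) < e"
    proof (cases "x = 0")
      case True
      have "p 0 = 0" using scale[of 0 0] by simp
      then show ?thesis using True \<open>e > 0\<close> by (intro exI[of _ 0]) simp
    next
      case False
      \<comment> \<open>The scaled vector has norm \<open>r / 2\<close>, inside the ball; the
        tolerance \<open>s * e\<close> becomes \<open>e\<close> after dividing by
        \<open>s\<close>.\<close>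
      define s where "s = r / (2 * norm x)"
      have s: "s > 0" using False r by (simp add: s_def)
      have "norm (s *\<^sub>R x) < r" using False r by (simp add: s_def)
      then obtain u where u: "p u \<le> n" "norm (s *\<^sub>R x - u) < s * e"
        using approx[of "s *\<^sub>R x" "s * e"] s \<open>e > 0\<close> by auto
      have "p ((1/s) *\<^sub>R u) = p u / s" using scale[of "1/s" u] s by simp
      also have "\<dots> \<le> real n / s" using u s by (simp add: divide_right_mono)
      also have "\<dots> \<le> C * norm x" using False r by (simp add: s_def C_def field_simps)
      finally have 1: "p ((1/s) *\<^sub>R u) \<le> C * norm x" .
      have "x - (1/s) *\<^sub>R u = (1/s) *\<^sub>R (s *\<^sub>R x - u)" using s by (simp add: algebra_simps)
      then have "norm (x - (1/s) *\<^sub>R u) = norm (s *\<^sub>R x - u) / s" using s by simp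
      also have "\<dots> < e" using u s by (simp add: field_simps)
      finally show ?thesis using 1 by blast
    qed
  qed
qed

text \<open>Each remainder is approximated with half the previous tolerance. The remainders tend to
  0, so the corrections telescope to \<open>x\<close>, and each correction is controlled by the norm
  of the remainder it approximates. A nonzero \<open>x\<close> makes all tolerances
  positive.\<close>

lemma successive_approximation_sums:
  fixes x :: "'a::{real_normed_vector, complete_space}"
  assumes approx: "\<And>x e. e > 0 \<Longrightarrow> \<exists>u. p u \<le> C * norm x \<and> norm (x - u) < e" and "C > 0" "x \<noteq> 0"
  obtains u where "u sums x" "\<And>k. p (u k) \<le> C * norm x * (1/2)^k"
proof -
  obtain U where U: "\<And>x e. e > 0 \<Longrightarrow> p (U x e) \<le> C * norm x \<and> norm (x - U x e) < e"
    using that[of "\<lambda>x e. SOME u. p u \<le> C * norm x \<and> norm (x - u) < e"] someI_ex[OF approx] by blast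
  \<comment> \<open>\<open>r k\<close> is the remainder after \<open>k\<close> corrections. The
    exponent is \<open>Suc k\<close> because the tolerance at stage \<open>k\<close> bounds
    \<open>r (Suc k)\<close>.\<close>
  define r where "r = rec_nat x (\<lambda>k y. y - U y (norm x * (1/2)^Suc k))"
  define u where "u k = U (r k) (norm x * (1/2)^Suc k)" for k
  have r0: "r 0 = x" and rS: "r (Suc k) = r k - u k" for k
    by (simp_all add: r_def u_def)
  have pos: "norm x * (1/2)^Suc k > 0" for k using \<open>x \<noteq> 0\<close> by simp
  have nr: "norm (r k) \<le> norm x * (1/2)^k" for k
  proof (cases k)
    case (Suc m)
    then show ?thesis using U[OF pos, of "r m" m] rS[of m] by (simp add: u_def)
  qed (simp add: r0)
  have "(\<lambda>k. norm x * (1/2)^k) \<longlonglongrightarrow> norm x * 0"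
    by (intro tendsto_mult tendsto_const LIMSEQ_power_zero) simp
  then have "(\<lambda>k. norm x * (1/2)^k) \<longlonglongrightarrow> 0" by simp
  then have "r \<longlonglongrightarrow> 0"
    by (rule Lim_null_comparison[rotated]) (simp add: nr)
  from telescope_sums'[OF this] have "u sums x" by (simp add: rS r0)
  moreover have "p (u k) \<le> C * norm x * (1/2)^k" for k
  proof -
    have "p (u k) \<le> C * norm (r k)" unfolding u_def using U[OF pos] by blast
    also have "\<dots> \<le> C * (norm x * (1/2)^k)" using nr[of k] \<open>C > 0\<close> by (simp add: mult_left_mono)
    finally show ?thesis by (simp add: mult.assoc)
  qed
  ultimately show thesis using that by blast
qed

text \<open>Approximability alone controls \<open>p\<close> near \<open>x\<close>, not at
  \<open>x\<close>. Expanding \<open>x\<close> into a series of approximants with geometrically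
  decaying \<open>p\<close>, countable subadditivity transfers the bound to \<open>x\<close>; the
  geometric series contributes the factor 2.\<close>

lemma countably_subadditive_seminorm_bounded:
  fixes p :: "'a::{real_normed_vector, complete_space} \<Rightarrow> real"
  assumes nonneg: "\<And>x. 0 \<le> p x"
    and scale: "\<And>c x. p (c *\<^sub>R x) = \<bar>c\<bar> * p x"
    and triangle: "\<And>x y. p (x + y) \<le> p x + p y"
    and countable: "\<And>f x. f sums x \<Longrightarrow> summable (\<lambda>k. p (f k)) \<Longrightarrow> p x \<le> (\<Sum>k. p (f k))"
  shows "\<exists>C>0. \<forall>x. p x \<le> C * norm x"
proof -
  obtain C where C: "C > 0" "\<And>x e. e > 0 \<Longrightarrow> \<exists>u. p u \<le> C * norm x \<and> norm (x - u) < e"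
    using seminorm_sublevel_dense[of p] assms by metis
  have "p x \<le> 2 * C * norm x" for x
  proof (cases "x = 0")
    case True
    then show ?thesis using scale[of 0 0] by simp
  next
    case False
    then obtain u where u: "u sums x" "\<And>k. p (u k) \<le> C * norm x * (1/2)^k"
      using successive_approximation_sums[of p C x] C by metis
    have geo: "(\<lambda>k. C * norm x * (1/2)^k) sums (C * norm x * 2)"
      using geometric_sums[of "1/2::real"] by (intro sums_mult) simp
    have sm: "summable (\<lambda>k. p (u k))"
      by (rule summable_comparison_test'[OF sums_summable[OF geo], of 0]) (simp add: u(2) nonneg)
    have "p x \<le> (\<Sum>k. p (u k))" using countable[OF u(1) sm] .
    also have "\<dots> \<le> C * norm x * 2"
      using suminf_le[OF u(2) sm sums_summable[OF geo]] sums_unique[OF geo] by simp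
    finally show ?thesis by (simp add: mult_ac)
  qed
  with C(1) show ?thesis by (intro exI[of _ "2 * C"]) simp
qed

section \<open>Orthogonal projection onto a closed subspace\<close>

text \<open>A minimizing sequence for the distance from \<open>x\<close> to \<open>W\<close> is
  Cauchy, its limit \<open>y\<close> is a nearest point in \<open>W\<close>, and minimality along
  the lines \<open>y + t *\<^sub>R z\<close> forces orthogonality.\<close>

lemma orthogonal_decomposition_closed_subspace:
  fixes W :: "'a::{real_inner, complete_space} set"
  assumes W: "subspace W" "closed W"
  obtains y where "y \<in> W" "x - y \<in> orthogonal_comp W"
proof -
  define d where "d = infdist x W"
  have ne: "W \<noteq> {}" using subspace_0[OF W(1)] by blast
  have dle: "d \<le> norm (x - w)" if "w \<in> W" for w
    using infdist_le[OF that] by (simp add: d_def dist_norm)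
  have d0: "d \<ge> 0" by (simp add: d_def infdist_nonneg)
  have "\<exists>w\<in>W. (norm (x - w))\<^sup>2 < d\<^sup>2 + inverse (Suc n)" for n
  proof -
    have "d < sqrt (d\<^sup>2 + inverse (Suc n))" by (rule real_less_rsqrt) simp
    then obtain w where w: "w \<in> W" "dist x w < sqrt (d\<^sup>2 + inverse (Suc n))"
      using cInf_lessD[of "dist x ` W"] ne unfolding d_def infdist_notempty[OF ne] by auto
    have "(dist x w)\<^sup>2 < (sqrt (d\<^sup>2 + inverse (Suc n)))\<^sup>2"
      using w(2) by (intro power_strict_mono) auto
    then show ?thesis using w(1) by (auto simp: dist_norm)
  qed
  then obtain w where w: "\<And>n. w n \<in> W" "\<And>n. (norm (x - w n))\<^sup>2 < d\<^sup>2 + inverse (Suc n)"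
    by metis
  \<comment> \<open>Parallelogram law: the midpoint of \<open>w m\<close> and \<open>w n\<close>
    lies in \<open>W\<close>, so its distance to \<open>x\<close> is at least
    \<open>d\<close>.\<close>
  have par: "(norm (w m - w n))\<^sup>2 \<le> 2 * inverse (Suc m) + 2 * inverse (Suc n)" for m n
  proof -
    have "(1/2) *\<^sub>R (w m + w n) \<in> W" using W(1) w(1) by (simp add: subspace_add subspace_scale)
    then have "d\<^sup>2 \<le> (norm (x - (1/2) *\<^sub>R (w m + w n)))\<^sup>2"
      using dle d0 by (intro power_mono) auto
    moreover have "(norm (w m - w n))\<^sup>2 + 4 * (norm (x - (1/2) *\<^sub>R (w m + w n)))\<^sup>2
        = 2 * (norm (x - w m))\<^sup>2 + 2 * (norm (x - w n))\<^sup>2"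
      by (simp add: power2_norm_eq_inner inner_diff_left inner_diff_right inner_add_left
          inner_add_right inner_commute algebra_simps)
    ultimately show ?thesis using w(2)[of m] w(2)[of n] by linarith
  qed
  have "Cauchy w"
  proof (rule metric_CauchyI)
    fix e :: real assume "e > 0"
    obtain M where M: "inverse (Suc M) < e\<^sup>2 / 4"
      using reals_Archimedean[of "e\<^sup>2 / 4"] \<open>e > 0\<close> by auto
    have "dist (w m) (w n) < e" if "m \<ge> M" "n \<ge> M" for m n
    proof -
      have "inverse (real (Suc m)) \<le> inverse (real (Suc M))" "inverse (real (Suc n)) \<le> inverse (real (Suc M))"
        using that by (auto intro!: le_imp_inverse_le)
      then have "(norm (w m - w n))\<^sup>2 < e\<^sup>2" using par[of m n] M by linarith
      then show ?thesis using \<open>e > 0\<close> by (simp add: dist_norm power_less_imp_less_base)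
    qed
    then show "\<exists>M. \<forall>m\<ge>M. \<forall>n\<ge>M. dist (w m) (w n) < e" by blast
  qed
  then obtain y where y: "w \<longlonglongrightarrow> y" using Cauchy_convergent convergent_def by blast
  have yW: "y \<in> W" using closed_sequentially[OF W(2)] w(1) y by blast
  have "(\<lambda>n. (norm (x - w n))\<^sup>2) \<longlonglongrightarrow> (norm (x - y))\<^sup>2" by (intro tendsto_intros y)
  moreover have "(\<lambda>n. d\<^sup>2 + inverse (Suc n)) \<longlonglongrightarrow> d\<^sup>2 + 0"
    by (intro tendsto_intros LIMSEQ_inverse_real_of_nat)
  ultimately have "(norm (x - y))\<^sup>2 \<le> d\<^sup>2 + 0"
    by (rule LIMSEQ_le) (use w(2) in \<open>auto intro: less_imp_le\<close>)
  then have min: "(norm (x - y))\<^sup>2 \<le> (norm (x - z))\<^sup>2" if "z \<in> W" for z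
    using power_mono[OF dle[OF that] d0, of 2] by linarith
  have "z \<bullet> (x - y) = 0" if z: "z \<in> W" for z
  proof (cases "z = 0")
    case False
    \<comment> \<open>The minimizer of the quadratic function
      \<open>t \<mapsto> norm ((x - y) - t *\<^sub>R z)\<close> squared.\<close>
    define t where "t = z \<bullet> (x - y) / (z \<bullet> z)"
    have "y + t *\<^sub>R z \<in> W" using W(1) yW z by (simp add: subspace_add subspace_scale)
    from min[OF this] have "(norm (x - y))\<^sup>2 \<le> (norm ((x - y) - t *\<^sub>R z))\<^sup>2" by (simp add: algebra_simps)
    also have "\<dots> = (norm (x - y))\<^sup>2 - 2 * t * (z \<bullet> (x - y)) + t * t * (z \<bullet> z)"
      unfolding power2_norm_eq_inner
      by (simp add: inner_diff_left inner_diff_right inner_commute algebra_simps)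
    also have "\<dots> = (norm (x - y))\<^sup>2 - (z \<bullet> (x - y))\<^sup>2 / (z \<bullet> z)"
      using False by (simp add: t_def power2_eq_square)
    finally have "(z \<bullet> (x - y))\<^sup>2 / (z \<bullet> z) \<le> 0" by simp
    moreover have "z \<bullet> z > 0" using False by simp
    ultimately show ?thesis by (simp add: divide_le_0_iff)
  qed simp
  then show thesis using that[OF yW] by (simp add: orthogonal_comp_def orthogonal_def)
qed

text \<open>The description in \<open>orthogonal_projection\<close> denotes: the difference of two
  candidates lies in \<open>W\<close> and is orthogonal to itself. The inner product identity later
  exchanges \<open>v'\<close> and its projection when testing against local balls.\<close>

lemma
  fixes W :: "'a::{real_inner, complete_space} set"
  assumes "subspace W" "closed W"
  shows orthogonal_projection_in: "orthogonal_projection W x \<in> W"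
    and inner_orthogonal_projection: "\<And>z. z \<in> W \<Longrightarrow> z \<bullet> orthogonal_projection W x = z \<bullet> x"
proof -
  let ?P = "\<lambda>y. y \<in> W \<and> x - y \<in> orthogonal_comp W"
  obtain y where y: "?P y" using orthogonal_decomposition_closed_subspace[OF assms] by blast
  have "y' = y" if "?P y'" for y'
  proof -
    have "y - y' \<in> W" using that y assms(1) by (simp add: subspace_diff)
    then have "(y - y') \<bullet> (x - y') = 0" "(y - y') \<bullet> (x - y) = 0"
      using that y by (auto simp: orthogonal_comp_def orthogonal_def)
    then have "(y - y') \<bullet> (y - y') = 0" by (simp add: inner_diff_right)
    then show ?thesis by simp
  qed
  then have "?P (orthogonal_projection W x)"
    unfolding orthogonal_projection_def using y by (intro theI[of ?P y])
  then show "orthogonal_projection W x \<in> W"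
    and "\<And>z. z \<in> W \<Longrightarrow> z \<bullet> orthogonal_projection W x = z \<bullet> x"
    by (auto simp: orthogonal_comp_def orthogonal_def inner_diff_right)
qed

section \<open>Norms on subspaces and their unit balls\<close>

lemma norm_onD:
  assumes "norm_on W N" "x \<in> W"
  shows norm_on_nonneg: "0 \<le> N x"
    and norm_on_eq_0_iff: "N x = 0 \<longleftrightarrow> x = 0"
    and norm_on_scale: "N (c *\<^sub>R x) = \<bar>c\<bar> * N x"
    and norm_on_triangle: "y \<in> W \<Longrightarrow> N (x + y) \<le> N x + N y"
  using assms unfolding norm_on_def by simp_all

text \<open>The reverse inequality is the given one for the scalar \<open>1/c\<close> and the vector
  \<open>c *\<^sub>R x\<close>; for \<open>c = 0\<close>, nonnegativity forces
  \<open>p 0 = 0\<close>.\<close>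

lemma absolutely_homogeneous_if_le:
  fixes p :: "'a::real_vector \<Rightarrow> real"
  assumes le: "\<And>c x. p (c *\<^sub>R x) \<le> \<bar>c\<bar> * p x" and nonneg: "\<And>x. 0 \<le> p x"
  shows "p (c *\<^sub>R x) = \<bar>c\<bar> * p x"
proof (cases "c = 0")
  case True
  then show ?thesis using le[of 0 x] nonneg[of 0] by simp
next
  case False
  then have "p x \<le> \<bar>1/c\<bar> * p (c *\<^sub>R x)" using le[of "1/c" "c *\<^sub>R x"] by simp
  then have "\<bar>c\<bar> * p x \<le> p (c *\<^sub>R x)" using False by (simp add: field_simps)
  then show ?thesis using le[of c x] by simp
qed

text \<open>Dividing a nonzero \<open>x\<close> by \<open>M x\<close> puts it into the unit ball of
  \<open>M\<close>, hence into that of \<open>N\<close>. Applied in both directions, this shows that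
  the unit ball determines the norm.\<close>

lemma norm_on_le_if_unit_ball_on_subset:
  assumes N: "norm_on W N" and M: "norm_on W M" and W: "subspace W"
    and sub: "unit_ball_on W M \<subseteq> unit_ball_on W N" and x: "x \<in> W"
  shows "N x \<le> M x"
proof (cases "x = 0")
  case True
  then show ?thesis using norm_on_eq_0_iff[OF N x] norm_on_eq_0_iff[OF M x] by simp
next
  case False
  then have pos: "M x > 0" using norm_on_eq_0_iff[OF M x] norm_on_nonneg[OF M x] by simp
  have "(1 / M x) *\<^sub>R x \<in> unit_ball_on W M"
    using pos x W by (simp add: unit_ball_on_def norm_on_scale[OF M x] subspace_scale)
  then have "N ((1 / M x) *\<^sub>R x) \<le> 1" using sub by (auto simp: unit_ball_on_def)
  then show ?thesis using pos by (simp add: norm_on_scale[OF N x] field_simps)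
qed

lemma norm_on_UNIV_eqI:
  assumes "norm_on UNIV N" "norm_on UNIV M" "unit_ball_on UNIV N = unit_ball_on UNIV M"
  shows "N = M"
proof
  show "N x = M x" for x
    using norm_on_le_if_unit_ball_on_subset[OF assms(1,2), of x]
      norm_on_le_if_unit_ball_on_subset[OF assms(2,1), of x] assms(3) by simp
qed

text \<open>The finite triangle inequality bounds the partial sums, and domination by the Hilbert
  norm makes the error \<open>N (s - S n)\<close> vanish in the limit.\<close>

lemma norm_on_countably_subadditive:
  assumes N: "norm_on W N" and W: "subspace W" and C: "\<And>x. x \<in> W \<Longrightarrow> N x \<le> C * norm x"
    and f: "\<And>k. f k \<in> W" "f sums s" "s \<in> W" and sm: "summable (\<lambda>k. N (f k))"
  shows "N s \<le> (\<Sum>k. N (f k))"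
proof -
  define S where "S n = (\<Sum>k<n. f k)" for n
  have SW: "S n \<in> W" for n using W f(1) by (simp add: S_def subspace_sum)
  have S_le: "N (S n) \<le> (\<Sum>k<n. N (f k))" for n
  proof (induction n)
    case 0
    then show ?case using norm_on_eq_0_iff[OF N subspace_0[OF W]] by (simp add: S_def)
  next
    case (Suc n)
    have "S (Suc n) = S n + f n" by (simp add: S_def)
    then show ?case using norm_on_triangle[OF N SW f(1), of n n] Suc by simp
  qed
  have le: "N s \<le> (\<Sum>k<n. N (f k)) + C * norm (s - S n)" for n
  proof -
    have "s - S n \<in> W" by (rule subspace_diff[OF W f(3) SW])
    then have "N (S n + (s - S n)) \<le> N (S n) + C * norm (s - S n)"
      using norm_on_triangle[OF N SW, of "s - S n" n] C[of "s - S n"] by linarith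
    then show ?thesis using S_le[of n] by simp
  qed
  have "(\<lambda>n. (\<Sum>k<n. N (f k)) + C * norm (s - S n)) \<longlonglongrightarrow> (\<Sum>k. N (f k)) + C * norm (s - s)"
    using summable_LIMSEQ[OF sm] f(2) unfolding sums_def S_def[symmetric] by (intro tendsto_intros)
  then have "(\<lambda>n. (\<Sum>k<n. N (f k)) + C * norm (s - S n)) \<longlonglongrightarrow> (\<Sum>k. N (f k))" by simp
  then show ?thesis by (rule LIMSEQ_le_const) (intro exI allI impI le)
qed

section \<open>Dual norm of a norm equivalent to the Hilbert norm\<close>

text \<open>One setting for both uses of duality: the local norms on \<open>V j\<close> and the
  global norm on \<open>UNIV\<close>.\<close>

locale equivalent_norm =
  fixes W :: "'a::real_inner set" and N :: "'a \<Rightarrow> real"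
  assumes subspace: "subspace W" and norm_on: "norm_on W N" and equiv: "equivalent_norms_on W N norm"
begin

lemma norm_bound: "\<exists>c>0. \<forall>x\<in>W. norm x \<le> c * N x"
  using equiv unfolding equivalent_norms_on_def by (rule conjunct2)

lemma bound_norm: "\<exists>C>0. \<forall>x\<in>W. N x \<le> C * norm x"
  using equiv unfolding equivalent_norms_on_def by (rule conjunct1)

lemma zero_in_unit_ball: "0 \<in> unit_ball_on W N"
  using subspace_0[OF subspace] norm_on_eq_0_iff[OF norm_on subspace_0[OF subspace]]
  by (simp add: unit_ball_on_def)

lemma inner_unit_ball_bounded: "\<exists>c>0. \<forall>x\<in>unit_ball_on W N. \<forall>y. x \<bullet> y \<le> c * norm y"
proof -
  obtain c where c: "c > 0" "\<And>x. x \<in> W \<Longrightarrow> norm x \<le> c * N x" using norm_bound by blast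
  have "x \<bullet> y \<le> c * norm y" if "x \<in> unit_ball_on W N" for x y
  proof -
    have "norm x \<le> c * N x" using that c(2) by (simp add: unit_ball_on_def)
    also have "\<dots> \<le> c" using that c(1) by (simp add: unit_ball_on_def)
    finally have "norm x * norm y \<le> c * norm y" by (simp add: mult_right_mono)
    then show ?thesis using norm_cauchy_schwarz[of x y] by linarith
  qed
  then show ?thesis using c(1) by blast
qed

text \<open>Cauchy-Schwarz bounds the support function above and the point 0 bounds it below, so it
  is finite at every \<open>y\<close>, inside \<open>W\<close> or not, and
  \<open>real_of_ereal\<close> in \<open>dual_norm\<close> loses nothing.\<close>

lemma support_function_unit_ball:
  "support_function (unit_ball_on W N) y = ereal (dual_norm W N y)"
proof -
  obtain c where c: "c > 0" "\<And>x y. x \<in> unit_ball_on W N \<Longrightarrow> x \<bullet> y \<le> c * norm y"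
    using inner_unit_ball_bounded by blast
  have "support_function (unit_ball_on W N) y \<le> ereal (c * norm y)"
    unfolding support_function_def using c(2) by (intro SUP_least) simp
  moreover have "ereal (0 \<bullet> y) \<le> support_function (unit_ball_on W N) y"
    unfolding support_function_def by (rule SUP_upper[OF zero_in_unit_ball])
  ultimately show ?thesis
    unfolding dual_norm_def by (cases "support_function (unit_ball_on W N) y") auto
qed

lemma dual_norm_le_iff: "dual_norm W N y \<le> c \<longleftrightarrow> (\<forall>x\<in>unit_ball_on W N. x \<bullet> y \<le> c)"
proof -
  have "dual_norm W N y \<le> c \<longleftrightarrow> support_function (unit_ball_on W N) y \<le> ereal c"
    unfolding support_function_unit_ball by simp
  also have "\<dots> \<longleftrightarrow> (\<forall>x\<in>unit_ball_on W N. x \<bullet> y \<le> c)"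
    unfolding support_function_def SUP_le_iff by simp
  finally show ?thesis .
qed

lemma inner_le_dual_norm: "x \<in> unit_ball_on W N \<Longrightarrow> x \<bullet> y \<le> dual_norm W N y"
  using dual_norm_le_iff[of y "dual_norm W N y"] by simp

lemma dual_norm_nonneg: "0 \<le> dual_norm W N y"
  using inner_le_dual_norm[OF zero_in_unit_ball, of y] by simp

lemma abs_inner_le_dual_norm:
  assumes "x \<in> unit_ball_on W N" shows "\<bar>x \<bullet> y\<bar> \<le> dual_norm W N y"
proof -
  have "- x \<in> unit_ball_on W N"
    using assms norm_on_scale[OF norm_on, of x "-1"] subspace_neg[OF subspace]
    by (simp add: unit_ball_on_def)
  from inner_le_dual_norm[OF this, of y] inner_le_dual_norm[OF assms, of y] show ?thesis by simp
qed

lemma inner_le_mult_dual_norm: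
  assumes "x \<in> W" shows "x \<bullet> y \<le> N x * dual_norm W N y"
proof (cases "x = 0")
  case True
  then show ?thesis using norm_on_eq_0_iff[OF norm_on assms] by simp
next
  case False
  then have pos: "N x > 0" using norm_on_eq_0_iff[OF norm_on assms] norm_on_nonneg[OF norm_on assms] by simp
  have "(1 / N x) *\<^sub>R x \<in> unit_ball_on W N"
    using pos assms subspace by (simp add: unit_ball_on_def norm_on_scale[OF norm_on] subspace_scale)
  from inner_le_dual_norm[OF this, of y] show ?thesis using pos by (simp add: field_simps)
qed

lemma dual_norm_scale: "dual_norm W N (c *\<^sub>R y) = \<bar>c\<bar> * dual_norm W N y"
proof (rule absolutely_homogeneous_if_le[of "dual_norm W N"])
  show "dual_norm W N (c *\<^sub>R y) \<le> \<bar>c\<bar> * dual_norm W N y" for c y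
    unfolding dual_norm_le_iff
  proof
    fix x assume x: "x \<in> unit_ball_on W N"
    have "x \<bullet> (c *\<^sub>R y) \<le> \<bar>c\<bar> * \<bar>x \<bullet> y\<bar>" using abs_ge_self[of "c * (x \<bullet> y)"] by (simp add: abs_mult)
    also have "\<dots> \<le> \<bar>c\<bar> * dual_norm W N y"
      using abs_inner_le_dual_norm[OF x] by (simp add: mult_left_mono)
    finally show "x \<bullet> (c *\<^sub>R y) \<le> \<bar>c\<bar> * dual_norm W N y" .
  qed
qed (rule dual_norm_nonneg)

text \<open>Testing the dual norm of \<open>y\<close> against \<open>y\<close> itself, which is why
  \<open>y\<close> must lie in \<open>W\<close>, and cancelling one factor
  \<open>norm y\<close>.\<close>

lemma norm_le_dual_norm: "\<exists>C>0. \<forall>y\<in>W. norm y \<le> C * dual_norm W N y"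
proof -
  obtain C where C: "C > 0" "\<And>x. x \<in> W \<Longrightarrow> N x \<le> C * norm x" using bound_norm by blast
  have "norm y \<le> C * dual_norm W N y" if "y \<in> W" for y
  proof (cases "y = 0")
    case False
    have "norm y * norm y \<le> N y * dual_norm W N y"
      using inner_le_mult_dual_norm[OF that, of y] by (simp add: norm_eq_sqrt_inner)
    also have "\<dots> \<le> C * norm y * dual_norm W N y"
      using C(2)[OF that] dual_norm_nonneg by (simp add: mult_right_mono)
    finally have "norm y * norm y \<le> norm y * (C * dual_norm W N y)" by (simp add: mult_ac)
    then show ?thesis using False by simp
  qed (use C dual_norm_nonneg in simp)
  then show ?thesis using C(1) by blast
qed

lemma norm_on_dual_norm: "norm_on W (dual_norm W N)"
  unfolding norm_on_def
proof (intro conjI ballI allI)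
  obtain C where C: "C > 0" "\<And>y. y \<in> W \<Longrightarrow> norm y \<le> C * dual_norm W N y"
    using norm_le_dual_norm by blast
  fix x y assume "x \<in> W"
  show "0 \<le> dual_norm W N x" by (rule dual_norm_nonneg)
  show "dual_norm W N x = 0 \<longleftrightarrow> x = 0"
    using C(2)[OF \<open>x \<in> W\<close>] dual_norm_scale[of 0 x] by auto
  show "dual_norm W N (c *\<^sub>R x) = \<bar>c\<bar> * dual_norm W N x" for c by (rule dual_norm_scale)
  show "dual_norm W N (x + y) \<le> dual_norm W N x + dual_norm W N y"
    unfolding dual_norm_le_iff inner_add_right by (intro ballI add_mono inner_le_dual_norm)
qed

lemma admits_dual_norm: "admits_dual_norm W N"
  unfolding admits_dual_norm_def
  by (intro exI[of _ "dual_norm W N"] conjI ballI norm_on_dual_norm support_function_unit_ball)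

lemma equivalent_dual_norm: "equivalent_norms_on W (dual_norm W N) norm"
proof -
  obtain c where c: "c > 0" "\<And>x y. x \<in> unit_ball_on W N \<Longrightarrow> x \<bullet> y \<le> c * norm y"
    using inner_unit_ball_bounded by blast
  obtain C where C: "C > 0" "\<And>y. y \<in> W \<Longrightarrow> norm y \<le> C * dual_norm W N y"
    using norm_le_dual_norm by blast
  have "dual_norm W N y \<le> c * norm y" for y using c(2) by (simp add: dual_norm_le_iff)
  then show ?thesis unfolding equivalent_norms_on_def using c(1) C by auto
qed

end

section \<open>The infimal convolution of the local norms and its equivalence to the Hilbert
  norm\<close>

locale local_norms =
  fixes J :: "'j set" and V :: "'j \<Rightarrow> 'v::{real_inner, complete_space} set"
    and Nloc :: "'j \<Rightarrow> 'v \<Rightarrow> real"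
  assumes finite: "finite J" and nonempty: "J \<noteq> {}"
    and closed: "\<And>j. j \<in> J \<Longrightarrow> closed (V j)"
    and sum_UNIV: "{\<Sum>j\<in>J. w j | w. \<forall>j\<in>J. w j \<in> V j} = UNIV"
    and equivalent_norm: "\<And>j. j \<in> J \<Longrightarrow> equivalent_norm (V j) (Nloc j)"
begin

lemmas subspace_V = equivalent_norm.subspace[OF equivalent_norm]
lemmas norm_on_V = equivalent_norm.norm_on[OF equivalent_norm]

definition decompositions :: "'v \<Rightarrow> ('j \<Rightarrow> 'v) set" where
  "decompositions v = {w. (\<forall>j\<in>J. w j \<in> V j) \<and> (\<Sum>j\<in>J. w j) = v}"

definition cost :: "('j \<Rightarrow> 'v) \<Rightarrow> real" where
  "cost w = (\<Sum>j\<in>J. Nloc j (w j))"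

text \<open>A real-valued form of the infimal convolution. This real infimum is meaningful because
  decompositions exist and costs are nonnegative; the \<open>ereal\<close> form is recovered in
  \<open>Ninf_eq_infimal_convolution\<close>.\<close>

definition Ninf :: "'v \<Rightarrow> real" where
  "Ninf v = (INF w\<in>decompositions v. cost w)"

lemma decompositions_nonempty: "decompositions v \<noteq> {}"
proof -
  have "v \<in> {\<Sum>j\<in>J. w j | w. \<forall>j\<in>J. w j \<in> V j}" using sum_UNIV by simp
  then show ?thesis by (auto simp: decompositions_def)
qed

lemma cost_nonneg: "w \<in> decompositions v \<Longrightarrow> 0 \<le> cost w"
  unfolding cost_def decompositions_def by (auto intro!: sum_nonneg norm_on_nonneg[OF norm_on_V])

lemma Ninf_le: "w \<in> decompositions v \<Longrightarrow> Ninf v \<le> cost w"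
  unfolding Ninf_def by (rule cINF_lower) (auto intro!: bdd_belowI2[of _ 0] cost_nonneg)

lemma Ninf_greatest: "(\<And>w. w \<in> decompositions v \<Longrightarrow> a \<le> cost w) \<Longrightarrow> a \<le> Ninf v"
  unfolding Ninf_def using decompositions_nonempty by (rule cINF_greatest)

lemma Ninf_approx:
  assumes "Ninf v < a" obtains w where "w \<in> decompositions v" "cost w < a"
  using Ninf_greatest[of v a] assms by fastforce

lemma Ninf_nonneg: "0 \<le> Ninf v"
  by (rule Ninf_greatest) (rule cost_nonneg)

lemma Ninf_scale: "Ninf (c *\<^sub>R v) = \<bar>c\<bar> * Ninf v"
proof (rule absolutely_homogeneous_if_le[of Ninf])
  fix c v
  have le: "Ninf (c *\<^sub>R v) \<le> \<bar>c\<bar> * cost w" if "w \<in> decompositions v" for w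
  proof -
    have "(\<lambda>j. c *\<^sub>R w j) \<in> decompositions (c *\<^sub>R v)"
      using that by (auto simp: decompositions_def subspace_scale[OF subspace_V] scaleR_sum_right)
    from Ninf_le[OF this] show ?thesis
      using that by (simp add: cost_def decompositions_def norm_on_scale[OF norm_on_V] sum_distrib_left)
  qed
  show "Ninf (c *\<^sub>R v) \<le> \<bar>c\<bar> * Ninf v"
  proof (cases "c = 0")
    case True
    then show ?thesis using le decompositions_nonempty[of v] by fastforce
  next
    case False
    then have "Ninf (c *\<^sub>R v) / \<bar>c\<bar> \<le> Ninf v" using le by (intro Ninf_greatest) (simp add: field_simps)
    then show ?thesis using False by (simp add: field_simps)
  qed
qed (rule Ninf_nonneg)

lemma Ninf_triangle: "Ninf (x + y) \<le> Ninf x + Ninf y"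
proof -
  have le: "Ninf (x + y) \<le> cost w + cost w'" if "w \<in> decompositions x" "w' \<in> decompositions y" for w w'
  proof -
    have "(\<lambda>j. w j + w' j) \<in> decompositions (x + y)"
      using that by (auto simp: decompositions_def subspace_add[OF subspace_V] sum.distrib)
    from Ninf_le[OF this] have "Ninf (x + y) \<le> (\<Sum>j\<in>J. Nloc j (w j + w' j))" by (simp add: cost_def)
    also have "\<dots> \<le> (\<Sum>j\<in>J. Nloc j (w j) + Nloc j (w' j))"
      using that by (intro sum_mono norm_on_triangle[OF norm_on_V]) (auto simp: decompositions_def)
    finally show ?thesis by (simp add: cost_def sum.distrib)
  qed
  \<comment> \<open>The two infima are taken one after the other, first over decompositions of
    \<open>y\<close>, then of \<open>x\<close>.\<close>
  have "Ninf (x + y) - cost w \<le> Ninf y" if "w \<in> decompositions x" for w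
  proof (rule Ninf_greatest)
    fix w' assume "w' \<in> decompositions y"
    then show "Ninf (x + y) - cost w \<le> cost w'" using le[OF that] by (simp add: diff_le_eq add.commute)
  qed
  then have "Ninf (x + y) - Ninf y \<le> Ninf x"
    by (intro Ninf_greatest) (simp add: algebra_simps)
  then show ?thesis by simp
qed

text \<open>The sum of the finitely many positive constants dominates each of them.\<close>

lemma uniform_norm_bound: "\<exists>c>0. \<forall>j\<in>J. \<forall>x\<in>V j. norm x \<le> c * Nloc j x"
proof -
  have "\<exists>c>0. \<forall>x\<in>V j. norm x \<le> c * Nloc j x" if "j \<in> J" for j
    by (rule equivalent_norm.norm_bound[OF equivalent_norm[OF that]])
  then obtain c where c: "\<And>j. j \<in> J \<Longrightarrow> c j > 0" "\<And>j x. j \<in> J \<Longrightarrow> x \<in> V j \<Longrightarrow> norm x \<le> c j * Nloc j x"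
    by metis
  show ?thesis
  proof (intro exI conjI ballI)
    show "(\<Sum>j\<in>J. c j) > 0" using c(1) finite nonempty by (intro sum_pos)
    fix j x assume j: "j \<in> J" "x \<in> V j"
    have "c j \<le> (\<Sum>j\<in>J. c j)" using j finite c(1) by (intro member_le_sum) (auto intro: less_imp_le)
    then have "c j * Nloc j x \<le> (\<Sum>j\<in>J. c j) * Nloc j x"
      using norm_on_nonneg[OF norm_on_V] j by (intro mult_right_mono)
    then show "norm x \<le> (\<Sum>j\<in>J. c j) * Nloc j x" using c(2)[OF j] by linarith
  qed
qed

text \<open>The elementary half of the equivalence: the Hilbert triangle inequality applied to each
  decomposition.\<close>

lemma norm_le_Ninf: "\<exists>c>0. \<forall>v. norm v \<le> c * Ninf v"
proof -
  obtain c where c: "c > 0" "\<And>j x. j \<in> J \<Longrightarrow> x \<in> V j \<Longrightarrow> norm x \<le> c * Nloc j x"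
    using uniform_norm_bound by blast
  have "norm v \<le> c * Ninf v" for v
  proof -
    have "norm v / c \<le> cost w" if "w \<in> decompositions v" for w
    proof -
      have "norm v \<le> (\<Sum>j\<in>J. norm (w j))" using that norm_sum[of w J] by (simp add: decompositions_def)
      also have "\<dots> \<le> (\<Sum>j\<in>J. c * Nloc j (w j))"
        using that c(2) by (intro sum_mono) (auto simp: decompositions_def)
      finally show ?thesis using c(1) by (simp add: cost_def field_simps sum_distrib_left)
    qed
    then have "norm v / c \<le> Ninf v" by (rule Ninf_greatest)
    then show ?thesis using c(1) by (simp add: field_simps)
  qed
  then show ?thesis using c(1) by blast
qed

text \<open>Nearly optimal decompositions of the terms are summed component by component.
  Completeness makes each component series converge, closedness keeps its sum in \<open>V j\<close>,
  and the sums form a decomposition of \<open>v\<close>.\<close>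

lemma Ninf_countably_subadditive:
  assumes f: "f sums v" and sm: "summable (\<lambda>k. Ninf (f k))"
  shows "Ninf v \<le> (\<Sum>k. Ninf (f k))"
proof (rule field_le_epsilon)
  fix e :: real assume e: "e > 0"
  \<comment> \<open>The slacks allowed in choosing the decompositions add up to
    \<open>e\<close>.\<close>
  let ?g = "\<lambda>k. Ninf (f k) + e * (1/2)^Suc k"
  have geo: "(\<lambda>k. e * (1/2)^Suc k) sums (e * 1)" using power_half_series by (rule sums_mult)
  then have smg: "summable ?g" using sm by (intro summable_add) (auto dest: sums_summable)
  have "\<exists>w\<in>decompositions (f k). cost w < ?g k" for k
    using Ninf_approx[of "f k" "?g k"] e by fastforce
  then obtain w where w: "\<And>k. w k \<in> decompositions (f k)" "\<And>k. cost (w k) < ?g k" by metis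
  have wV: "w k j \<in> V j" if "j \<in> J" for j k using w(1) that by (auto simp: decompositions_def)
  have term_le: "Nloc j (w k j) \<le> cost (w k)" if "j \<in> J" for j k
    unfolding cost_def using that finite wV
    by (intro member_le_sum[of j J "\<lambda>j. Nloc j (w k j)"]) (auto intro: norm_on_nonneg[OF norm_on_V])
  have smN: "summable (\<lambda>k. Nloc j (w k j))" if "j \<in> J" for j
  proof (rule summable_comparison_test'[OF smg, of 0])
    fix k show "norm (Nloc j (w k j)) \<le> ?g k"
      using term_le[OF that, of k] w(2)[of k] norm_on_nonneg[OF norm_on_V[OF that] wV[OF that, of k]]
      by simp
  qed
  obtain c where c: "c > 0" "\<And>j x. j \<in> J \<Longrightarrow> x \<in> V j \<Longrightarrow> norm x \<le> c * Nloc j x"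
    using uniform_norm_bound by blast
  define s where "s j = (\<Sum>k. w k j)" for j
  have s: "(\<lambda>k. w k j) sums s j" if "j \<in> J" for j
  proof -
    have "summable (\<lambda>k. norm (w k j))"
      by (rule summable_comparison_test'[OF summable_mult[OF smN[OF that], of c], of 0])
        (simp add: c(2)[OF that wV[OF that]])
    then show ?thesis unfolding s_def by (intro summable_sums[OF summable_if_summable_norm])
  qed
  have sV: "s j \<in> V j" if "j \<in> J" for j
    using closed_sequentially[OF closed[OF that] _ s[OF that, unfolded sums_def]] wV[OF that]
    by (simp add: subspace_sum[OF subspace_V[OF that]])
  have "(\<lambda>k. \<Sum>j\<in>J. w k j) sums (\<Sum>j\<in>J. s j)" by (rule sums_sum) (rule s)
  moreover have "(\<lambda>k. \<Sum>j\<in>J. w k j) = f" using w(1) by (auto simp: decompositions_def)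
  ultimately have "(\<Sum>j\<in>J. s j) = v" using f sums_unique2 by metis
  then have "s \<in> decompositions v" using sV by (simp add: decompositions_def)
  then have "Ninf v \<le> cost s" by (rule Ninf_le)
  also have "\<dots> \<le> (\<Sum>j\<in>J. \<Sum>k. Nloc j (w k j))"
    unfolding cost_def
  proof (rule sum_mono)
    fix j assume j: "j \<in> J"
    obtain C where C: "C > 0" "\<And>x. x \<in> V j \<Longrightarrow> Nloc j x \<le> C * norm x"
      using equivalent_norm.bound_norm[OF equivalent_norm[OF j]] by blast
    show "Nloc j (s j) \<le> (\<Sum>k. Nloc j (w k j))"
      by (rule norm_on_countably_subadditive[OF norm_on_V[OF j] subspace_V[OF j] C(2)])
        (use j wV s sV smN in auto)
  qed
  also have "\<dots> = (\<Sum>k. cost (w k))" unfolding cost_def using smN by (simp add: suminf_sum)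
  also have "\<dots> \<le> (\<Sum>k. ?g k)"
  proof (rule suminf_le[OF _ _ smg])
    show "summable (\<lambda>k. cost (w k))" unfolding cost_def using smN by (rule summable_sum)
  qed (use w(2) in \<open>auto intro: less_imp_le\<close>)
  also have "\<dots> = (\<Sum>k. Ninf (f k)) + e"
    using suminf_add[OF sm sums_summable[OF geo]] sums_unique[OF geo] by simp
  finally show "Ninf v \<le> (\<Sum>k. Ninf (f k)) + e" .
qed

text \<open>The deep half of the equivalence, obtained from Zabreiko's lemma.\<close>

lemma Ninf_le_norm: "\<exists>C>0. \<forall>v. Ninf v \<le> C * norm v"
  by (rule countably_subadditive_seminorm_bounded)
    (simp_all add: Ninf_nonneg Ninf_scale Ninf_triangle Ninf_countably_subadditive)

sublocale Ninf: equivalent_norm UNIV Ninf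
proof
  obtain c where c: "c > 0" "\<And>v. norm v \<le> c * Ninf v" using norm_le_Ninf by blast
  obtain C where C: "C > 0" "\<And>v. Ninf v \<le> C * norm v" using Ninf_le_norm by blast
  show "subspace (UNIV :: 'v set)" by simp
  have "Ninf v = 0 \<longleftrightarrow> v = 0" for v
    using c(2)[of v] Ninf_scale[of 0 v] by auto
  then show "norm_on UNIV Ninf"
    using Ninf_nonneg Ninf_scale Ninf_triangle by (simp add: norm_on_def)
  show "equivalent_norms_on UNIV Ninf norm" using c C unfolding equivalent_norms_on_def by blast
qed

section \<open>The unit ball of \<open>Ninf\<close> as a closed convex hull\<close>

abbreviation unit_balls :: "'v set" (\<open>\<B>\<close>) where
  "\<B> \<equiv> \<Union>j\<in>J. unit_ball_on (V j) (Nloc j)"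

text \<open>The decomposition concentrated at \<open>j\<close> is a competitor in the
  infimum.\<close>

lemma Ninf_le_local:
  assumes "j \<in> J" "x \<in> V j" shows "Ninf x \<le> Nloc j x"
proof -
  let ?w = "\<lambda>i. if i = j then x else 0"
  have w: "?w \<in> decompositions x"
    using assms finite subspace_0[OF subspace_V] by (auto simp: decompositions_def)
  have "Nloc i 0 = 0" if "i \<in> J" for i
    using norm_on_eq_0_iff[OF norm_on_V[OF that] subspace_0[OF subspace_V[OF that]]] by simp
  then have "cost ?w = (\<Sum>i\<in>J. if i = j then Nloc j x else 0)"
    unfolding cost_def by (intro sum.cong) auto
  then show ?thesis using Ninf_le[OF w] assms finite by simp
qed

lemma convex_unit_ball_Ninf: "convex (unit_ball_on UNIV Ninf)"
proof (rule convexI)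
  fix x y and u v :: real
  assume "x \<in> unit_ball_on UNIV Ninf" "y \<in> unit_ball_on UNIV Ninf" and uv: "0 \<le> u" "0 \<le> v" "u + v = 1"
  then have "u * Ninf x + v * Ninf y \<le> u * 1 + v * 1"
    by (intro add_mono mult_left_mono) (auto simp: unit_ball_on_def)
  then show "u *\<^sub>R x + v *\<^sub>R y \<in> unit_ball_on UNIV Ninf"
    using Ninf_triangle[of "u *\<^sub>R x" "v *\<^sub>R y"] uv by (simp add: Ninf_scale unit_ball_on_def)
qed

text \<open>Domination by the Hilbert norm makes \<open>Ninf\<close> Lipschitz, so the bound 1
  survives limits.\<close>

lemma closed_unit_ball_Ninf: "Topological_Spaces.closed (unit_ball_on UNIV Ninf)"
  unfolding closed_sequential_limits
proof (intro allI impI)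
  fix x l assume "(\<forall>n. x n \<in> unit_ball_on UNIV Ninf) \<and> x \<longlonglongrightarrow> l"
  then have x: "\<And>n. Ninf (x n) \<le> 1" "x \<longlonglongrightarrow> l" by (auto simp: unit_ball_on_def)
  obtain C where C: "C > 0" "\<And>v. Ninf v \<le> C * norm v" using Ninf_le_norm by blast
  have "Ninf l \<le> 1 + C * norm (l - x n)" for n
    using Ninf_triangle[of "x n" "l - x n"] x(1)[of n] C(2)[of "l - x n"] by simp
  moreover have "(\<lambda>n. 1 + C * norm (l - x n)) \<longlonglongrightarrow> 1 + C * norm (l - l)"
    by (intro tendsto_intros x)
  ultimately have "Ninf l \<le> 1 + C * norm (l - l)" by (intro LIMSEQ_le_const) auto
  then show "l \<in> unit_ball_on UNIV Ninf" by (simp add: unit_ball_on_def)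
qed

text \<open>Strictness yields an actual decomposition of cost below 1. Its normalized components lie
  in the local balls, and their local norms serve as weights.\<close>

lemma in_convex_hull_if_Ninf_less_1:
  assumes "Ninf v < 1" shows "v \<in> convex hull \<B>"
proof -
  obtain w where w: "w \<in> decompositions v" "cost w < 1" using Ninf_approx[OF assms] by blast
  have wV: "w j \<in> V j" if "j \<in> J" for j using w(1) that by (auto simp: decompositions_def)
  \<comment> \<open>If \<open>w j = 0\<close>, division by zero gives \<open>z j = 0\<close>, still
    a point of the local ball.\<close>
  define z where "z j = (1 / Nloc j (w j)) *\<^sub>R w j" for j
  have zB: "z j \<in> \<B>" if "j \<in> J" for j
    using that wV[OF that] norm_on_nonneg[OF norm_on_V[OF that] wV[OF that]]
    by (auto simp: z_def unit_ball_on_def norm_on_scale[OF norm_on_V] subspace_scale[OF subspace_V]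
        intro!: bexI[of _ j])
  have zero: "0 \<in> \<B>" using nonempty equivalent_norm.zero_in_unit_ball[OF equivalent_norm] by blast
  have z: "Nloc j (w j) *\<^sub>R z j = w j" if "j \<in> J" for j
    using norm_on_eq_0_iff[OF norm_on_V[OF that] wV[OF that]] by (auto simp: z_def)
  text \<open>The missing weight \<open>1 - cost w\<close> is put on the point \<open>0\<close>.\<close>
  define u where "u i = (case i of None \<Rightarrow> 1 - cost w | Some j \<Rightarrow> Nloc j (w j))" for i
  define y where "y i = (case i of None \<Rightarrow> 0 | Some j \<Rightarrow> z j)" for i
  let ?I = "insert None (Some ` J)"
  have "(\<Sum>i\<in>?I. u i *\<^sub>R y i) \<in> convex hull \<B>"
  proof (rule convex_sum)
    show "(\<Sum>i\<in>?I. u i) = 1" using finite by (simp add: sum.reindex u_def cost_def)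
    show "0 \<le> u i" if "i \<in> ?I" for i
      using that w(2) by (auto simp: u_def intro: norm_on_nonneg[OF norm_on_V wV])
    show "y i \<in> convex hull \<B>" if "i \<in> ?I" for i
      using that zB zero by (auto simp: y_def intro!: hull_inc)
  qed (use finite in auto)
  moreover have "(\<Sum>i\<in>?I. u i *\<^sub>R y i) = v"
    using finite z w(1) by (simp add: sum.reindex u_def y_def decompositions_def)
  ultimately show ?thesis by simp
qed

text \<open>One inclusion is minimality of the closed convex hull. For the other, shrinking
  \<open>v\<close> by factors below 1 that tend to 1 gives points of the convex hull converging to
  \<open>v\<close>.\<close>

lemma unit_ball_Ninf: "unit_ball_on UNIV Ninf = closure (convex hull \<B>)"
proof
  have "\<B> \<subseteq> unit_ball_on UNIV Ninf"
    using Ninf_le_local by (fastforce simp: unit_ball_on_def)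
  then show "closure (convex hull \<B>) \<subseteq> unit_ball_on UNIV Ninf"
    by (intro closure_minimal hull_minimal convex_unit_ball_Ninf closed_unit_ball_Ninf)
  show "unit_ball_on UNIV Ninf \<subseteq> closure (convex hull \<B>)"
  proof
    fix v assume v: "v \<in> unit_ball_on UNIV Ninf"
    define x where "x n = (1 - inverse (real (Suc n))) *\<^sub>R v" for n
    have "Ninf (x n) < 1" for n
    proof -
      have "Ninf (x n) = (1 - inverse (real (Suc n))) * Ninf v"
        unfolding x_def Ninf_scale by (simp add: field_simps)
      also have "\<dots> \<le> (1 - inverse (real (Suc n))) * 1"
        using v by (intro mult_left_mono) (auto simp: unit_ball_on_def field_simps)
      finally show ?thesis by (smt (verit) inverse_positive_iff_positive of_nat_0_less_iff zero_less_Suc)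
    qed
    then have "x n \<in> convex hull \<B>" for n by (rule in_convex_hull_if_Ninf_less_1)
    moreover have "x \<longlonglongrightarrow> (1 - 0) *\<^sub>R v"
      unfolding x_def by (intro tendsto_intros LIMSEQ_inverse_real_of_nat)
    ultimately show "v \<in> closure (convex hull \<B>)" by (auto simp: closure_sequential)
  qed
qed

section \<open>The polar set and the global dual norm\<close>

text \<open>A closed half-space is closed and convex, so it contains the closed convex hull as soon
  as it contains \<open>\<B>\<close>. Both the polar set and the dual norm formula rest on
  this.\<close>

lemma inner_le_on_unit_ball_Ninf_iff:
  "(\<forall>x\<in>unit_ball_on UNIV Ninf. x \<bullet> y \<le> c) \<longleftrightarrow> (\<forall>x\<in>\<B>. x \<bullet> y \<le> c)"
proof
  assume "\<forall>x\<in>\<B>. x \<bullet> y \<le> c"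
  then have "closure (convex hull \<B>) \<subseteq> {x. y \<bullet> x \<le> c}"
    by (intro closure_minimal hull_minimal convex_halfspace_le closed_halfspace_le)
      (auto simp: inner_commute)
  then show "\<forall>x\<in>unit_ball_on UNIV Ninf. x \<bullet> y \<le> c"
    unfolding unit_ball_Ninf by (auto simp: inner_commute)
next
  assume "\<forall>x\<in>unit_ball_on UNIV Ninf. x \<bullet> y \<le> c"
  then show "\<forall>x\<in>\<B>. x \<bullet> y \<le> c"
    unfolding unit_ball_Ninf using closure_subset hull_subset by (meson subsetD)
qed

lemma unit_ball_dual_Ninf: "unit_ball_on UNIV (dual_norm UNIV Ninf) = polar_set \<B>"
  unfolding polar_set_def unit_ball_on_def[of UNIV "dual_norm _ _"]
  by (auto simp only: Ninf.dual_norm_le_iff inner_le_on_unit_ball_Ninf_iff)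

text \<open>The half-space test splits over the local balls, and on \<open>V j\<close> the vector
  \<open>y\<close> and its projection have the same inner products.\<close>

lemma dual_Ninf_le_iff:
  "dual_norm UNIV Ninf y \<le> c \<longleftrightarrow>
    (\<forall>j\<in>J. dual_norm (V j) (Nloc j) (orthogonal_projection (V j) y) \<le> c)"
proof -
  have "dual_norm (V j) (Nloc j) (orthogonal_projection (V j) y) \<le> c \<longleftrightarrow>
      (\<forall>x\<in>unit_ball_on (V j) (Nloc j). x \<bullet> y \<le> c)" if "j \<in> J" for j
    unfolding equivalent_norm.dual_norm_le_iff[OF equivalent_norm[OF that]]
    by (intro ball_cong)
      (auto simp: unit_ball_on_def inner_orthogonal_projection[OF subspace_V[OF that] closed[OF that]])
  then show ?thesis unfolding Ninf.dual_norm_le_iff inner_le_on_unit_ball_Ninf_iff by auto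
qed

text \<open>Both sides have the same upper bounds \<open>c\<close>; finiteness and nonemptiness of
  \<open>J\<close> make the real supremum well behaved.\<close>

lemma dual_Ninf_eq_SUP:
  "dual_norm UNIV Ninf y = (SUP j\<in>J. dual_norm (V j) (Nloc j) (orthogonal_projection (V j) y))"
proof (rule order_antisym)
  let ?D = "\<lambda>j. dual_norm (V j) (Nloc j) (orthogonal_projection (V j) y)"
  show "dual_norm UNIV Ninf y \<le> (SUP j\<in>J. ?D j)"
    unfolding dual_Ninf_le_iff using finite by (auto intro!: cSUP_upper)
  show "(SUP j\<in>J. ?D j) \<le> dual_norm UNIV Ninf y"
    using nonempty dual_Ninf_le_iff[of y "dual_norm UNIV Ninf y"] by (auto intro!: cSUP_least)
qed

section \<open>The infimum formulas for the norm\<close>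

lemma Ninf_eq_Inf:
  "Ninf v = Inf {\<Sum>j\<in>J. Nloc j (w j) | w. (\<forall>j\<in>J. w j \<in> V j) \<and> (\<Sum>j\<in>J. w j) = v}"
  unfolding Ninf_def decompositions_def cost_def by (simp add: setcompr_eq_image)

text \<open>A family with some component outside its \<open>V j\<close> has value \<infinity>, so
  only the families in \<open>decompositions v\<close> affect the infimum.\<close>

lemma Ninf_eq_infimal_convolution:
  "ereal (Ninf v) = infimal_convolution J (\<lambda>j x. ereal (Nloc j x) + convex_indicator (V j) x) v"
proof (rule order_antisym)
  let ?f = "\<lambda>w. \<Sum>j\<in>J. ereal (Nloc j (w j)) + convex_indicator (V j) (w j)"
  have val: "?f w = ereal (cost w)" if "\<forall>j\<in>J. w j \<in> V j" for w
    using that by (simp add: cost_def convex_indicator_def)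
  show "ereal (Ninf v) \<le> infimal_convolution J (\<lambda>j x. ereal (Nloc j x) + convex_indicator (V j) x) v"
    unfolding infimal_convolution_def
  proof (rule INF_greatest)
    fix w assume w: "w \<in> {w. (\<Sum>j\<in>J. w j) = v}"
    show "ereal (Ninf v) \<le> ?f w"
    proof (cases "\<forall>j\<in>J. w j \<in> V j")
      case True
      then show ?thesis using w val Ninf_le[of w v] by (simp add: decompositions_def)
    next
      case False
      then have "?f w = \<infinity>" using finite by (auto simp: sum_Pinfty convex_indicator_def)
      then show ?thesis by simp
    qed
  qed
  show "infimal_convolution J (\<lambda>j x. ereal (Nloc j x) + convex_indicator (V j) x) v \<le> ereal (Ninf v)"
  proof (rule ereal_le_epsilon2)
    fix e :: real assume "e > 0"
    then obtain w where w: "w \<in> decompositions v" "cost w < Ninf v + e"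
      using Ninf_approx[of v "Ninf v + e"] by auto
    have "infimal_convolution J (\<lambda>j x. ereal (Nloc j x) + convex_indicator (V j) x) v \<le> ?f w"
      unfolding infimal_convolution_def using w(1) by (intro INF_lower) (simp add: decompositions_def)
    also have "\<dots> \<le> ereal (Ninf v + e)" using w val by (simp add: decompositions_def)
    finally show "infimal_convolution J (\<lambda>j x. ereal (Nloc j x) + convex_indicator (V j) x) v
        \<le> ereal (Ninf v) + ereal e" by simp
  qed
qed

end

section \<open>Assembly of the results\<close>

theorem proposition15:
  fixes J :: "'j set"
    and V :: "'j \<Rightarrow> 'v::{real_inner, complete_space} set"
    and Nloc :: "'j \<Rightarrow> 'v \<Rightarrow> real"
    and B :: "'j \<Rightarrow> 'v set"
  assumes "finite J" and "J \<noteq> {}"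
    and "\<And>j. j \<in> J \<Longrightarrow> subspace (V j)"
    and "\<And>j. j \<in> J \<Longrightarrow> closed (V j)"
    and "{\<Sum>j\<in>J. w j | w. \<forall>j\<in>J. w j \<in> V j} = UNIV"
    and "\<And>j. j \<in> J \<Longrightarrow> norm_on (V j) (Nloc j)"
    and "\<And>j. j \<in> J \<Longrightarrow> equivalent_norms_on (V j) (Nloc j) norm"
    and "\<And>j. j \<in> J \<Longrightarrow> B j = unit_ball_on (V j) (Nloc j)"
  shows "(\<exists>!N. norm_on UNIV N \<and> unit_ball_on UNIV N = closure (convex hull (\<Union>j\<in>J. B j))) \<and>
    (\<forall>N. norm_on UNIV N \<and> unit_ball_on UNIV N = closure (convex hull (\<Union>j\<in>J. B j)) \<longrightarrow>
      admits_dual_norm UNIV N \<and>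
      unit_ball_on UNIV (dual_norm UNIV N) = polar_set (\<Union>j\<in>J. B j) \<and>
      equivalent_norms_on UNIV N norm \<and>
      equivalent_norms_on UNIV (dual_norm UNIV N) norm \<and>
      (\<forall>v. ereal (N v) =
         infimal_convolution J (\<lambda>j x. ereal (Nloc j x) + convex_indicator (V j) x) v) \<and>
      (\<forall>v. N v = Inf {\<Sum>j\<in>J. Nloc j (w j) | w. (\<forall>j\<in>J. w j \<in> V j) \<and> (\<Sum>j\<in>J. w j) = v}) \<and>
      (\<forall>j\<in>J. admits_dual_norm (V j) (Nloc j)) \<and>
      (\<forall>v'. dual_norm UNIV N v' =
         (SUP j\<in>J. dual_norm (V j) (Nloc j) (orthogonal_projection (V j) v'))))"
proof -
  interpret local_norms J V Nloc
    using assms by unfold_locales (auto simp: equivalent_norm_def)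
  have B: "(\<Union>j\<in>J. B j) = \<B>"
    using assms(8) by (rule SUP_cong[OF refl])
  \<comment> \<open>The unit ball determines the norm, so each claim about an arbitrary such
    \<open>N\<close> becomes one about \<open>Ninf\<close>.\<close>
  have unique: "N = Ninf"
    if "norm_on UNIV N \<and> unit_ball_on UNIV N = closure (convex hull (\<Union>j\<in>J. B j))" for N
    using that norm_on_UNIV_eqI[OF _ Ninf.norm_on, of N] by (simp add: B unit_ball_Ninf)
  show ?thesis
  proof (intro conjI allI impI)
    show "\<exists>!N. norm_on UNIV N \<and> unit_ball_on UNIV N = closure (convex hull (\<Union>j\<in>J. B j))"
    proof (rule ex1I)
      show "norm_on UNIV Ninf \<and> unit_ball_on UNIV Ninf = closure (convex hull (\<Union>j\<in>J. B j))"
        by (simp add: B Ninf.norm_on unit_ball_Ninf)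
    qed (rule unique)
    fix N
    assume "norm_on UNIV N \<and> unit_ball_on UNIV N = closure (convex hull (\<Union>j\<in>J. B j))"
    then have N: "N = Ninf" by (rule unique)
    show "admits_dual_norm UNIV N" unfolding N by (rule Ninf.admits_dual_norm)
    show "unit_ball_on UNIV (dual_norm UNIV N) = polar_set (\<Union>j\<in>J. B j)"
      unfolding N B by (rule unit_ball_dual_Ninf)
    show "equivalent_norms_on UNIV N norm" unfolding N by (rule Ninf.equiv)
    show "equivalent_norms_on UNIV (dual_norm UNIV N) norm" unfolding N by (rule Ninf.equivalent_dual_norm)
    show "ereal (N v) = infimal_convolution J (\<lambda>j x. ereal (Nloc j x) + convex_indicator (V j) x) v" for v
      unfolding N by (rule Ninf_eq_infimal_convolution)
    show "N v = Inf {\<Sum>j\<in>J. Nloc j (w j) | w. (\<forall>j\<in>J. w j \<in> V j) \<and> (\<Sum>j\<in>J. w j) = v}" for v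
      unfolding N by (rule Ninf_eq_Inf)
    show "\<forall>j\<in>J. admits_dual_norm (V j) (Nloc j)"
      using equivalent_norm.admits_dual_norm[OF equivalent_norm] by blast
    show "dual_norm UNIV N v' =
        (SUP j\<in>J. dual_norm (V j) (Nloc j) (orthogonal_projection (V j) v'))" for v'
      unfolding N by (rule dual_Ninf_eq_SUP)
  qed
qed

end
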